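(* For any given value of the vector $\xi=(y,d_0)$, where $y=(y_i)_{i\in I}$ and $d_0=(d_{0,i})_{i\in I}$, the bilevel problem $$\mathrm{(SWS)}\qquad \max_{p,v}\ \sum_{i=1}^n (1-c)\,p_i\min(x_i(v)+y_i,\,d_i)\quad\text{s.t.}\quad p_i\in[p_{i,\min},p_{i,\max}]\ \ \forall i\in I,\qquad v \text{ solves } F(p),$$ is equivalent, in the sense of local and global solutions, to the single-level problem $$\mathrm{(MPCC)}\qquad \max_{p,v,\lambda,\gamma,\beta}\ \sum_{i=1}^n (1-c)\,p_i\min(x_i(v)+y_i,\,d_i)$$ subject to $$\begin{cases} p_i\in[p_{i,\min},p_{i,\max}], & \forall i\in I,\\ \sum_{j\neq i}v_{ij}-x_{0,i}\le 0, & \forall i\in I,\\ c(\beta_i-\beta_j)+\alpha_{ij}-\lambda_{ij}+\gamma_i=0, & \forall i\neq j\in I,\\ \gamma_i\big(\sum_{j\neq i}v_{ij}-x_{0,i}\big)=0, & \forall i\in I,\\ \lambda_{ij}v_{ij}=0, & \forall i\neq j\in I,\\ v\ge 0,\ \gamma\ge 0,\ \lambda\ge 0, \end{cases}$$ where the variables $\beta=(\beta_i)_{i\in I}$ verify, with $x_i=x_i(v)$ and $d_i=d_i(p_i)$, $$\beta_i\in\begin{cases}\{0\} & \text{if } d_i-x_i<y_i,\\ \{p_i\} & \text{if } d_i-x_i>y_i,\\ [0,p_i] & \text{if } d_i-x_i=y_i,\end{cases}\qquad \forall i\in I.$$ Furthermore, for every feasible point $(p,v,\lambda,\gamma,\beta)$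 of (MPCC), the multipliers $\gamma=(\gamma_i)_{i\in I}$ and $\lambda=(\lambda_{ij})_{i\neq j\in I}$ verify $$0\le\gamma_i\le 2p_{\max}\quad (i\in I)\qquad\text{and}\qquad 0\le\lambda_{ij}\le 4p_{\max}+\alpha_{ij}\quad (i\neq j\in I),$$ where $p_{\max}=\max_{i\in I}p_{i,\max}$.
   Context: Data: $I=\{1,\ldots,n\}$ (zones); $c\in(0,1)$; price bounds $0\le p_{i,\min}<p_{i,\max}$; reallocation costs $\alpha_{ij}\ge 0$ for $i\neq j$; initial allocation $x_0=(x_{0,1},\dots,x_{0,n})$ with $x_{0,i}>0$ for all $i$; a constant $\delta$. The given vector $\xi=(y,d_0)$ has nonnegative entries. Demand: $d_i=d_i(p_i)=d_{0,i}\Big(1-\delta\frac{p_i-p_{i,\min}}{p_{i,\max}-p_{i,\min}}\Big)$ for $i\in I$. Variables: $v=(v_{ij})_{i\neq j\in I}\in\mathbb{R}^{n(n-1)}$ and, for $j\in I$, $x_j(v)=x_{0,j}+\sum_{i\neq j}v_{ij}-\sum_{k\neq j}v_{jk}$. Follower's problem under shared information, $F(p)$ (for fixed $p$ and the given $y,d_0$): $$\min_v\ \sum_{i=1}^n c\,p_i\max(-x_i(v)-y_i,\,-d_i)+\sum_{i\neq j}\alpha_{ij}v_{ij}\quad\text{s.t.}\quad v\ge 0,\ \ \sum_{j\neq i}v_{ij}\le x_{0,i}\ \ \forall i\in I;$$ "$v$ solves $F(p)$" means $v$ is a global minimizer. Equivalence in the sense of local and global solutions: (global) $(p,v)$ is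 a global solution of the bilevel problem if and only if there exist $(\lambda,\gamma,\beta)$ such that $(p,v,\lambda,\gamma,\beta)$ is a global solution of (MPCC); (local) a bilevel-feasible point $(p,v)$ is a local solution of the bilevel problem if and only if $(p,v,\lambda,\gamma,\beta)$ is a local solution of (MPCC) for every $(\lambda,\gamma,\beta)$ such that $(p,v,\lambda,\gamma,\beta)$ is feasible for (MPCC). *)

theory Defs
  imports "HOL-Analysis.Analysis"
begin

text \<open>
  Zones are the elements of a finite index type \<open>'n\<close>, so \<open>n = CARD('n) \<ge> 1\<close>.

  A family \<open>(v\<^sub>i\<^sub>j)\<close> indexed by pairs \<open>i \<noteq> j\<close>, i.e. a point of the space of dimension
  \<open>n (n - 1)\<close>, is represented by a square matrix. For the variables of the optimization problems
  the meaningless diagonal is fixed to zero, so that points are counted once and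
  neighbourhoods are those of the space of dimension \<open>n (n - 1)\<close>.
\<close>

definition off_diagonal :: "(real^'n^'n) set" where
  "off_diagonal = {v. \<forall>i. v $ i $ i = 0}"

text \<open>Only the off-diagonal entries of \<open>realloc_cost\<close> are used.\<close>

record 'n market =
  commission :: real         \<comment> \<open>\<open>c\<close>\<close>
  price_min :: "real^'n"
  price_max :: "real^'n"
  realloc_cost :: "real^'n^'n" \<comment> \<open>\<open>\<alpha>\<close>\<close>
  init_alloc :: "real^'n"    \<comment> \<open>\<open>x\<^sub>0\<close>\<close>
  elasticity :: real         \<comment> \<open>\<open>\<delta>\<close>\<close>

definition demand :: "'n market \<Rightarrow> real^'n \<Rightarrow> real^'n \<Rightarrow> 'n \<Rightarrow> real" where
  "demand M d0 p i =
     d0 $ i * (1 - elasticity M *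
       ((p $ i - price_min M $ i) / (price_max M $ i - price_min M $ i)))"

definition alloc :: "'n market \<Rightarrow> real^'n^'n \<Rightarrow> 'n::finite \<Rightarrow> real" where
  "alloc M v j = init_alloc M $ j + (\<Sum>i | i \<noteq> j. v $ i $ j) - (\<Sum>k | k \<noteq> j. v $ j $ k)"

definition price_box :: "'n market \<Rightarrow> (real^'n) set" where
  "price_box M = {p. \<forall>i. p $ i \<in> {price_min M $ i .. price_max M $ i}}"

definition flow_feasible :: "'n::finite market \<Rightarrow> (real^'n^'n) set" where
  "flow_feasible M =
     {v \<in> off_diagonal. (\<forall>i j. i \<noteq> j \<longrightarrow> 0 \<le> v $ i $ j) \<and>
        (\<forall>i. (\<Sum>j | j \<noteq> i. v $ i $ j) \<le> init_alloc M $ i)}"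

definition follower_cost ::
  "'n::finite market \<Rightarrow> real^'n \<Rightarrow> real^'n \<Rightarrow> real^'n \<Rightarrow> real^'n^'n \<Rightarrow> real" where
  "follower_cost M y d0 p v =
     (\<Sum>i\<in>UNIV. commission M * p $ i * max (- alloc M v i - y $ i) (- demand M d0 p i)) +
     (\<Sum>i\<in>UNIV. \<Sum>j | j \<noteq> i. realloc_cost M $ i $ j * v $ i $ j)"

definition solves_follower ::
  "'n::finite market \<Rightarrow> real^'n \<Rightarrow> real^'n \<Rightarrow> real^'n \<Rightarrow> real^'n^'n \<Rightarrow> bool" where
  "solves_follower M y d0 p v \<longleftrightarrow>
     is_arg_min (follower_cost M y d0 p) (\<lambda>w. w \<in> flow_feasible M) v"

definition leader_profit ::
  "'n::finite market \<Rightarrow> real^'n \<Rightarrow> real^'n \<Rightarrow> real^'n \<Rightarrow> real^'n^'n \<Rightarrow> real" where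
  "leader_profit M y d0 p v =
     (\<Sum>i\<in>UNIV. (1 - commission M) * p $ i * min (alloc M v i + y $ i) (demand M d0 p i))"

definition bilevel_feasible ::
  "'n::finite market \<Rightarrow> real^'n \<Rightarrow> real^'n \<Rightarrow> ((real^'n) \<times> (real^'n^'n)) set" where
  "bilevel_feasible M y d0 = {(p, v). p \<in> price_box M \<and> solves_follower M y d0 p v}"

definition bilevel_objective ::
  "'n::finite market \<Rightarrow> real^'n \<Rightarrow> real^'n \<Rightarrow> (real^'n) \<times> (real^'n^'n) \<Rightarrow> real" where
  "bilevel_objective M y d0 = (\<lambda>(p, v). leader_profit M y d0 p v)"

definition beta_set ::
  "'n::finite market \<Rightarrow> real^'n \<Rightarrow> real^'n \<Rightarrow> real^'n \<Rightarrow> real^'n^'n \<Rightarrow> 'n \<Rightarrow> real set" where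
  "beta_set M y d0 p v i =
     (if demand M d0 p i - alloc M v i < y $ i then {0}
      else if demand M d0 p i - alloc M v i > y $ i then {p $ i}
      else {0 .. p $ i})"

text \<open>Points are \<open>(p, v, l, \<gamma>, \<beta>)\<close>, with \<open>l\<close> for the multiplier \<open>\<lambda>\<close>.\<close>

type_synonym 'n mpcc_point =
  "(real^'n) \<times> (real^'n^'n) \<times> (real^'n^'n) \<times> (real^'n) \<times> (real^'n)"

definition mpcc_feasible ::
  "'n::finite market \<Rightarrow> real^'n \<Rightarrow> real^'n \<Rightarrow> 'n mpcc_point set" where
  "mpcc_feasible M y d0 = {(p, v, l, \<gamma>, \<beta>).
     v \<in> off_diagonal \<and> l \<in> off_diagonal \<and>
     p \<in> price_box M \<and>
     (\<forall>i. (\<Sum>j | j \<noteq> i. v $ i $ j) - init_alloc M $ i \<le> 0) \<and>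
     (\<forall>i j. i \<noteq> j \<longrightarrow>
        commission M * (\<beta> $ i - \<beta> $ j) + realloc_cost M $ i $ j - l $ i $ j + \<gamma> $ i = 0) \<and>
     (\<forall>i. \<gamma> $ i * ((\<Sum>j | j \<noteq> i. v $ i $ j) - init_alloc M $ i) = 0) \<and>
     (\<forall>i j. i \<noteq> j \<longrightarrow> l $ i $ j * v $ i $ j = 0) \<and>
     (\<forall>i j. i \<noteq> j \<longrightarrow> 0 \<le> v $ i $ j) \<and>
     (\<forall>i. 0 \<le> \<gamma> $ i) \<and>
     (\<forall>i j. i \<noteq> j \<longrightarrow> 0 \<le> l $ i $ j) \<and>
     (\<forall>i. \<beta> $ i \<in> beta_set M y d0 p v i)}"

definition mpcc_objective ::
  "'n::finite market \<Rightarrow> real^'n \<Rightarrow> real^'n \<Rightarrow> 'n mpcc_point \<Rightarrow> real" where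
  "mpcc_objective M y d0 = (\<lambda>(p, v, l, \<gamma>, \<beta>). leader_profit M y d0 p v)"

definition global_solution :: "('a \<Rightarrow> real) \<Rightarrow> 'a set \<Rightarrow> 'a \<Rightarrow> bool" where
  "global_solution f S z \<longleftrightarrow> is_arg_max f (\<lambda>w. w \<in> S) z"

definition local_solution :: "('a::topological_space \<Rightarrow> real) \<Rightarrow> 'a set \<Rightarrow> 'a \<Rightarrow> bool" where
  "local_solution f S z \<longleftrightarrow> z \<in> S \<and> (\<forall>\<^sub>F w in at z within S. f w \<le> f z)"

end

theory Submission
  imports Defs
begin

text \<open>
  The follower minimizes a convex piecewise linear function over a polyhedron. The cost of a zone
  depends on the flow through \<open>max (- x\<^sub>i - y\<^sub>i) (- d\<^sub>i)\<close>, whose slopes with respect to \<open>x\<^sub>i\<close>, after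
  multiplication by \<open>p\<^sub>i \<ge> 0\<close>, are the numbers \<open>- \<beta>\<^sub>i\<close> with \<open>\<beta>\<^sub>i\<close> in the interval \<open>beta_set\<close>. Hence the
  subdifferential of the cost consists of the matrices
  \<open>reduced_cost M \<beta> = (c (\<beta>\<^sub>i - \<beta>\<^sub>j) + \<alpha>\<^sub>i\<^sub>j)\<close>, and optimality of \<open>v\<close> means that the negative of one of them
  lies in the normal cone of the feasible flows at \<open>v\<close>, whose elements are the matrices
  \<open>(\<gamma>\<^sub>i - \<lambda>\<^sub>i\<^sub>j)\<close> with \<open>\<gamma>\<close> and \<open>\<lambda>\<close> nonnegative and complementary to the constraints.

  Sufficiency (in \<open>solves_follower_iff\<close>) is the subgradient inequality
  \<open>follower_cost_subgradient\<close>. For necessity, if no such \<open>\<beta>\<close> exists, a hyperplane strictly separates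
  the compact convex set of reduced costs from the closed convex cone opposite to the normal cone;
  its normal vector is a feasible direction (\<open>descent_direction\<close>, \<open>feasible_direction\<close>) along which,
  by \<open>follower_cost_directional\<close>, the cost decreases. The constraints being linear, no constraint
  qualification is needed.

  So the bilevel feasible set is the projection to \<open>(p, v)\<close> of the feasible set of the single-level
  problem, and the two objectives agree along the projection; this gives the claim on global
  solutions. If \<open>\<gamma>\<^sub>i > 0\<close>, zone \<open>i\<close> sends out its whole positive allocation, so that \<open>v\<^sub>i\<^sub>j > 0\<close> and
  \<open>\<lambda>\<^sub>i\<^sub>j = 0\<close> for some \<open>j\<close>; the stationarity equations then bound all multipliers
  (\<open>multiplier_bounds\<close>). With these bounds the feasible set of the single-level problem is compact,
  and local solutions correspond because the projection of a compact set is a closed map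
  (\<open>local_solution_project\<close>).
\<close>

section \<open>Solutions and continuous projections\<close>

lemma local_solution_iff:
  "local_solution f S z \<longleftrightarrow> z \<in> S \<and> (\<exists>U. open U \<and> z \<in> U \<and> (\<forall>w\<in>U \<inter> S. f w \<le> f z))"
  unfolding local_solution_def eventually_at_topological by auto

lemma global_solution_mem: "global_solution f S z \<Longrightarrow> z \<in> S"
  by (simp add: global_solution_def is_arg_max_def)

lemma global_solution_project:
  "global_solution f (\<pi> ` S) x \<longleftrightarrow> (\<exists>z\<in>S. \<pi> z = x \<and> global_solution (f \<circ> \<pi>) S z)"
  unfolding global_solution_def is_arg_max_def by auto

text \<open>
  The backward direction uses compactness: the points of \<open>S\<close> outside a neighbourhood of the fibre
  over \<open>x\<close> project to a closed set that misses \<open>x\<close>.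
\<close>

lemma local_solution_project:
  fixes \<pi> :: "'a::topological_space \<Rightarrow> 'b::t2_space"
  assumes S: "compact S" and \<pi>: "continuous_on UNIV \<pi>" and x: "x \<in> \<pi> ` S"
  shows "local_solution f (\<pi> ` S) x \<longleftrightarrow>
    (\<forall>z\<in>S. \<pi> z = x \<longrightarrow> local_solution (f \<circ> \<pi>) S z)"
proof
  assume "local_solution f (\<pi> ` S) x"
  then obtain U where U: "open U" "x \<in> U" "\<forall>w\<in>U \<inter> \<pi> ` S. f w \<le> f x"
    unfolding local_solution_iff by blast
  have "open (\<pi> -` U)"
    using \<pi> U(1) by (simp add: open_vimage)
  then show "\<forall>z\<in>S. \<pi> z = x \<longrightarrow> local_solution (f \<circ> \<pi>) S z"
    unfolding local_solution_iff using U by (force intro!: exI[of _ "\<pi> -` U"])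
next
  assume loc: "\<forall>z\<in>S. \<pi> z = x \<longrightarrow> local_solution (f \<circ> \<pi>) S z"
  \<comment> \<open>the largest open set on whose part in \<open>S\<close> the objective stays at most \<open>f x\<close>\<close>
  define W where "W = \<Union>{U. open U \<and> (\<forall>w\<in>U \<inter> S. f (\<pi> w) \<le> f x)}"
  have "open W" and W: "\<And>w. w \<in> W \<Longrightarrow> w \<in> S \<Longrightarrow> f (\<pi> w) \<le> f x"
    unfolding W_def by auto
  have fibre: "z \<in> W" if "z \<in> S" "\<pi> z = x" for z
    using loc that unfolding local_solution_iff W_def by fastforce
  have "compact (S - W)"
    using S \<open>open W\<close> by (rule compact_diff)
  then have "closed (\<pi> ` (S - W))"
    by (intro compact_imp_closed compact_continuous_image continuous_on_subset[OF \<pi>]) auto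
  then have "open (- \<pi> ` (S - W))" by auto
  moreover have "x \<in> - \<pi> ` (S - W)" using fibre by auto
  moreover have "f w \<le> f x" if "w \<in> - \<pi> ` (S - W) \<inter> \<pi> ` S" for w
    using that W by auto
  ultimately show "local_solution f (\<pi> ` S) x"
    unfolding local_solution_iff using x by blast
qed

section \<open>The follower's cost along a change of flow\<close>

text \<open>
  The change of the allocation of zone \<open>j\<close> caused by the flow \<open>v\<close>.
\<close>

definition net_inflow :: "real^'n^'n \<Rightarrow> 'n::finite \<Rightarrow> real" where
  "net_inflow v j = (\<Sum>i | i \<noteq> j. v $ i $ j) - (\<Sum>k | k \<noteq> j. v $ j $ k)"

text \<open>
  The gradient, with respect to the flow, of the follower's cost when the cost of zone \<open>i\<close> has
  slope \<open>- c \<beta>\<^sub>i\<close> with respect to its allocation. The diagonal is set to zero, so that it plays no role in inner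
  products.
\<close>

definition reduced_cost :: "'n::finite market \<Rightarrow> real^'n \<Rightarrow> real^'n^'n" where
  "reduced_cost M \<beta> = (\<chi> i j. if i = j then 0 else
     commission M * (\<beta> $ i - \<beta> $ j) + realloc_cost M $ i $ j)"

lemma alloc_net_inflow: "alloc M v j = init_alloc M $ j + net_inflow v j"
  by (simp add: alloc_def net_inflow_def)

lemma net_inflow_add: "net_inflow (v + w) j = net_inflow v j + net_inflow w j"
  by (simp add: net_inflow_def sum.distrib)

lemma net_inflow_diff: "net_inflow (v - w) j = net_inflow v j - net_inflow w j"
  by (simp add: net_inflow_def sum_subtractf)

lemma net_inflow_scaleR: "net_inflow (t *\<^sub>R v) j = t * net_inflow v j"
  by (simp add: net_inflow_def sum_distrib_left right_diff_distrib)

text \<open>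
  Summation by parts: a unit sent from \<open>i\<close> to \<open>j\<close> gains \<open>\<beta>\<^sub>j\<close> and loses \<open>\<beta>\<^sub>i\<close>.
\<close>

lemma sum_mult_net_inflow:
  fixes \<beta> :: "real^'n::finite"
  shows "(\<Sum>i\<in>UNIV. \<beta> $ i * net_inflow a i) = (\<Sum>i\<in>UNIV. \<Sum>j | j \<noteq> i. (\<beta> $ j - \<beta> $ i) * a $ i $ j)"
proof -
  have "(\<Sum>i\<in>UNIV. \<Sum>k | k \<noteq> i. \<beta> $ i * a $ k $ i) = (\<Sum>k\<in>UNIV. \<Sum>i | i \<noteq> k. \<beta> $ i * a $ k $ i)"
    using sum.swap_restrict[of UNIV UNIV "\<lambda>i k. \<beta> $ i * a $ k $ i" "\<lambda>i k. k \<noteq> i"]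
    by (simp add: eq_commute)
  then show ?thesis
    by (simp add: net_inflow_def right_diff_distrib left_diff_distrib sum_subtractf sum_distrib_left)
qed

lemma reduced_cost_sum:
  "(\<Sum>i\<in>UNIV. \<Sum>j | j \<noteq> i. reduced_cost M \<beta> $ i $ j * a $ i $ j) =
   (\<Sum>i\<in>UNIV. \<Sum>j | j \<noteq> i. realloc_cost M $ i $ j * a $ i $ j)
     - commission M * (\<Sum>i\<in>UNIV. \<beta> $ i * net_inflow a i)"
  unfolding sum_mult_net_inflow sum_distrib_left sum_subtractf[symmetric]
  by (intro sum.cong refl) (auto simp: reduced_cost_def algebra_simps)

lemma reduced_cost_inner:
  "reduced_cost M \<beta> \<bullet> a = (\<Sum>i\<in>UNIV. \<Sum>j | j \<noteq> i. reduced_cost M \<beta> $ i $ j * a $ i $ j)"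
proof -
  have "(\<Sum>j\<in>UNIV. reduced_cost M \<beta> $ i $ j * a $ i $ j) = (\<Sum>j | j \<noteq> i. reduced_cost M \<beta> $ i $ j * a $ i $ j)" for i
    by (rule sum.mono_neutral_right) (auto simp: reduced_cost_def)
  then show ?thesis by (simp add: inner_vec_def)
qed

lemma follower_cost_subgradient:
  fixes M :: "'n::finite market"
  assumes c: "0 \<le> commission M" and p: "\<And>i. 0 \<le> p $ i"
    and \<beta>: "\<And>i. \<beta> $ i \<in> beta_set M y d0 p v i"
  shows "follower_cost M y d0 p v + reduced_cost M \<beta> \<bullet> (w - v) \<le> follower_cost M y d0 p w"
proof -
  have "p $ i * max (- alloc M v i - y $ i) (- demand M d0 p i) - \<beta> $ i * net_inflow (w - v) i
      \<le> p $ i * max (- alloc M w i - y $ i) (- demand M d0 p i)" for i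
  proof -
    define d where "d = demand M d0 p i"
    define e where "e = d - alloc M v i - y $ i"
    define s where "s = net_inflow (w - v) i"
    have w: "alloc M w i = alloc M v i + s"
      by (simp add: s_def alloc_net_inflow net_inflow_diff)
    have shift: "p $ i * max (- a - y $ i) (- d) = p $ i * max (d - a - y $ i) 0 - p $ i * d" for a
      by (simp add: max_def algebra_simps)
    \<comment> \<open>\<open>\<beta>\<^sub>i\<close> attains the maximum of \<open>b * e\<close> over \<open>b \<in> [0, p\<^sub>i]\<close>, which is \<open>p\<^sub>i * max e 0\<close>\<close>
    have "0 \<le> \<beta> $ i" "\<beta> $ i \<le> p $ i" "\<beta> $ i * e = p $ i * max e 0"
      using \<beta>[of i] p[of i] unfolding beta_set_def e_def d_def
      by (auto split: if_splits)
    moreover have "\<beta> $ i * (e - s) \<le> p $ i * max (e - s) 0"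
      using calculation(1,2) p[of i]
      by (cases "e - s \<ge> 0") (auto simp: max_def mult_right_mono mult_nonneg_nonpos)
    ultimately have "p $ i * max e 0 - \<beta> $ i * s \<le> p $ i * max (e - s) 0"
      by (simp add: algebra_simps)
    then show ?thesis
      unfolding d_def[symmetric] s_def[symmetric] w shift e_def by (simp add: algebra_simps)
  qed
  then have "(\<Sum>i\<in>UNIV. commission M * (p $ i * max (- alloc M v i - y $ i) (- demand M d0 p i) - \<beta> $ i * net_inflow (w - v) i))
      \<le> (\<Sum>i\<in>UNIV. commission M * (p $ i * max (- alloc M w i - y $ i) (- demand M d0 p i)))"
    by (intro sum_mono mult_left_mono c)
  then show ?thesis
    unfolding follower_cost_def reduced_cost_inner reduced_cost_sum
    by (simp add: sum_subtractf sum_distrib_left right_diff_distrib mult.assoc)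
qed

text \<open>
  The cost is piecewise linear, so in every direction \<open>a\<close> it is given, for small steps, exactly by
  a subgradient. Which one depends on \<open>a\<close>: where demand equals supply, \<open>\<beta>\<^sub>i\<close> is \<open>p\<^sub>i\<close> or \<open>0\<close> according to
  whether \<open>a\<close> decreases the allocation of zone \<open>i\<close> or not.
\<close>

lemma follower_cost_directional:
  fixes M :: "'n::finite market"
  assumes p: "\<And>i. 0 \<le> p $ i"
  shows "\<exists>\<beta>. (\<forall>i. \<beta> $ i \<in> beta_set M y d0 p v i) \<and>
    (\<forall>\<^sub>F t in at_right 0. follower_cost M y d0 p (v + t *\<^sub>R a)
       = follower_cost M y d0 p v + t * (reduced_cost M \<beta> \<bullet> a))"
proof -
  have "\<exists>b. b \<in> beta_set M y d0 p v i \<and> (\<forall>\<^sub>F t in at_right 0.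
      p $ i * max (- alloc M (v + t *\<^sub>R a) i - y $ i) (- demand M d0 p i)
      = p $ i * max (- alloc M v i - y $ i) (- demand M d0 p i) - t * (b * net_inflow a i))" for i
  proof -
    define d where "d = demand M d0 p i"
    define e where "e = d - alloc M v i - y $ i"
    define s where "s = net_inflow a i"
    have v: "- alloc M v i - y $ i = e - d"
      "- alloc M (v + t *\<^sub>R a) i - y $ i = e - t * s - d" for t
      by (simp_all add: e_def s_def alloc_net_inflow net_inflow_add net_inflow_scaleR)
    have lim: "((\<lambda>t. e - t * s) \<longlongrightarrow> e) (at_right 0)"
      by (auto intro!: tendsto_eq_intros)
    consider "e < 0" | "e > 0" | "e = 0" "s \<ge> 0" | "e = 0" "s < 0" by linarith
    then have "\<exists>b. b \<in> beta_set M y d0 p v i \<and>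
      (\<forall>\<^sub>F t in at_right 0. p $ i * max (e - t * s - d) (- d) = p $ i * max (e - d) (- d) - t * (b * s))"
    proof cases
      case 1
      then show ?thesis
        using order_tendstoD(2)[OF lim, of 0]
        by (intro exI[of _ 0]) (auto simp: beta_set_def e_def d_def elim!: eventually_mono)
    next
      case 2
      have "\<forall>\<^sub>F t in at_right 0. p $ i * max (e - t * s - d) (- d) = p $ i * max (e - d) (- d) - t * (p $ i * s)"
        using order_tendstoD(1)[OF lim, of 0] 2
        by (auto simp: max_def algebra_simps elim!: eventually_mono)
      then show ?thesis
        using 2 by (intro exI[of _ "p $ i"]) (auto simp: beta_set_def e_def d_def)
    next
      case 3
      have ev: "\<forall>\<^sub>F t in at_right 0. p $ i * max (e - t * s - d) (- d) = p $ i * max (e - d) (- d) - t * (0 * s)"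
        using eventually_at_right_less[of 0]
      proof eventually_elim
        case (elim t)
        then have "0 \<le> t * s" using 3 by simp
        then show ?case using 3 by (simp add: max_def)
      qed
      have "0 \<in> beta_set M y d0 p v i"
        using 3 p[of i] by (simp add: beta_set_def e_def d_def)
      with ev show ?thesis by blast
    next
      case 4
      have ev: "\<forall>\<^sub>F t in at_right 0. p $ i * max (e - t * s - d) (- d) = p $ i * max (e - d) (- d) - t * (p $ i * s)"
        using eventually_at_right_less[of 0]
      proof eventually_elim
        case (elim t)
        then have "t * s < 0" using 4 by (simp add: mult_pos_neg)
        then show ?case using 4 by (simp add: max_def algebra_simps)
      qed
      have "p $ i \<in> beta_set M y d0 p v i"
        using 4 p[of i] by (simp add: beta_set_def e_def d_def)
      with ev show ?thesis by blast
    qed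
    then show ?thesis
      unfolding v d_def[symmetric] s_def[symmetric] .
  qed
  then have "\<exists>b. \<forall>i. b i \<in> beta_set M y d0 p v i \<and> (\<forall>\<^sub>F t in at_right 0.
      p $ i * max (- alloc M (v + t *\<^sub>R a) i - y $ i) (- demand M d0 p i)
      = p $ i * max (- alloc M v i - y $ i) (- demand M d0 p i) - t * (b i * net_inflow a i))"
    by (intro choice allI)
  then obtain b where b: "\<And>i. b i \<in> beta_set M y d0 p v i"
    and ev: "\<And>i. \<forall>\<^sub>F t in at_right 0.
      p $ i * max (- alloc M (v + t *\<^sub>R a) i - y $ i) (- demand M d0 p i)
      = p $ i * max (- alloc M v i - y $ i) (- demand M d0 p i) - t * (b i * net_inflow a i)"
    by blast
  have "\<forall>\<^sub>F t in at_right 0. \<forall>i.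
      p $ i * max (- alloc M (v + t *\<^sub>R a) i - y $ i) (- demand M d0 p i)
      = p $ i * max (- alloc M v i - y $ i) (- demand M d0 p i) - t * (b i * net_inflow a i)"
    by (rule eventually_all_finite) (rule ev)
  then have "\<forall>\<^sub>F t in at_right 0. follower_cost M y d0 p (v + t *\<^sub>R a)
       = follower_cost M y d0 p v + t * (reduced_cost M (\<chi> i. b i) \<bullet> a)"
  proof eventually_elim
    case (elim t)
    have "commission M * p $ i * max (- alloc M (v + t *\<^sub>R a) i - y $ i) (- demand M d0 p i)
      = commission M * p $ i * max (- alloc M v i - y $ i) (- demand M d0 p i)
        - t * (commission M * (b i * net_inflow a i))" for i
      unfolding mult.assoc elim[rule_format] by (simp only: right_diff_distrib mult.left_commute)
    then have "(\<Sum>i\<in>UNIV. commission M * p $ i * max (- alloc M (v + t *\<^sub>R a) i - y $ i) (- demand M d0 p i))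
      = (\<Sum>i\<in>UNIV. commission M * p $ i * max (- alloc M v i - y $ i) (- demand M d0 p i))
        - t * (commission M * (\<Sum>i\<in>UNIV. b i * net_inflow a i))"
      by (simp only: sum_subtractf sum_distrib_left)
    moreover have "(\<Sum>i\<in>UNIV. \<Sum>j | j \<noteq> i. realloc_cost M $ i $ j * (v + t *\<^sub>R a) $ i $ j)
      = (\<Sum>i\<in>UNIV. \<Sum>j | j \<noteq> i. realloc_cost M $ i $ j * v $ i $ j)
        + t * (\<Sum>i\<in>UNIV. \<Sum>j | j \<noteq> i. realloc_cost M $ i $ j * a $ i $ j)"
      by (simp add: distrib_left sum.distrib sum_distrib_left mult.left_commute)
    ultimately show ?case
      unfolding follower_cost_def reduced_cost_inner reduced_cost_sum
      by (simp add: right_diff_distrib)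
  qed
  then show ?thesis
    using b by (intro exI[of _ "\<chi> i. b i"]) simp
qed

section \<open>Karush-Kuhn-Tucker conditions for the follower\<close>

text \<open>
  Nonnegative multipliers that satisfy complementary slackness at the flow \<open>v\<close>: \<open>\<gamma>\<close> for the bounds on the total
  outflows and \<open>l\<close> for the sign constraints.
\<close>

definition multipliers :: "'n::finite market \<Rightarrow> real^'n^'n \<Rightarrow> real^'n \<Rightarrow> real^'n^'n \<Rightarrow> bool" where
  "multipliers M v \<gamma> l \<longleftrightarrow> l \<in> off_diagonal \<and>
     (\<forall>i. 0 \<le> \<gamma> $ i) \<and> (\<forall>i j. i \<noteq> j \<longrightarrow> 0 \<le> l $ i $ j) \<and>
     (\<forall>i. \<gamma> $ i * ((\<Sum>j | j \<noteq> i. v $ i $ j) - init_alloc M $ i) = 0) \<and>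
     (\<forall>i j. i \<noteq> j \<longrightarrow> l $ i $ j * v $ i $ j = 0)"

text \<open>
  For feasible \<open>v\<close>, the cone generated by the gradients of the constraints active at \<open>v\<close>, in the
  space of matrices with zero diagonal.
\<close>

definition normal_cone :: "'n::finite market \<Rightarrow> real^'n^'n \<Rightarrow> (real^'n^'n) set" where
  "normal_cone M v = {m \<in> off_diagonal. \<exists>\<gamma> l. multipliers M v \<gamma> l \<and>
     (\<forall>i j. i \<noteq> j \<longrightarrow> m $ i $ j = \<gamma> $ i - l $ i $ j)}"

lemma normal_coneI:
  assumes "m \<in> off_diagonal" "multipliers M v \<gamma> l" "\<And>i j. i \<noteq> j \<Longrightarrow> m $ i $ j = \<gamma> $ i - l $ i $ j"
  shows "m \<in> normal_cone M v"
  using assms unfolding normal_cone_def by blast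

lemma mpcc_feasible_iff:
  "(p, v, l, \<gamma>, \<beta>) \<in> mpcc_feasible M y d0 \<longleftrightarrow>
     p \<in> price_box M \<and> v \<in> flow_feasible M \<and> multipliers M v \<gamma> l \<and>
     (\<forall>i j. i \<noteq> j \<longrightarrow> reduced_cost M \<beta> $ i $ j = l $ i $ j - \<gamma> $ i) \<and>
     (\<forall>i. \<beta> $ i \<in> beta_set M y d0 p v i)"
proof -
  have "(\<forall>i j. i \<noteq> j \<longrightarrow> reduced_cost M \<beta> $ i $ j = l $ i $ j - \<gamma> $ i) \<longleftrightarrow>
    (\<forall>i j. i \<noteq> j \<longrightarrow>
        commission M * (\<beta> $ i - \<beta> $ j) + realloc_cost M $ i $ j - l $ i $ j + \<gamma> $ i = 0)"
    by (auto simp: reduced_cost_def algebra_simps)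
  then show ?thesis
    unfolding mpcc_feasible_def flow_feasible_def multipliers_def
    by (simp add: conj_ac)
qed

lemma saturated_zone_flow:
  fixes M :: "'n::finite market"
  assumes "0 < init_alloc M $ i" "(\<Sum>j | j \<noteq> i. v $ i $ j) = init_alloc M $ i"
  obtains j where "j \<noteq> i" "0 < v $ i $ j"
proof -
  have "\<exists>j\<in>{j. j \<noteq> i}. 0 < v $ i $ j"
  proof (rule ccontr)
    assume "\<not> ?thesis"
    then have "(\<Sum>j | j \<noteq> i. v $ i $ j) \<le> 0" by (intro sum_nonpos) force
    then show False using assms by simp
  qed
  then show ?thesis using that by blast
qed

lemma zero_in_normal_cone: "0 \<in> normal_cone M v"
  unfolding normal_cone_def multipliers_def off_diagonal_def
  by (auto intro!: exI[of _ 0])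

lemma normal_cone_scaleR:
  assumes "m \<in> normal_cone M v" "0 \<le> t"
  shows "t *\<^sub>R m \<in> normal_cone M v"
proof -
  obtain \<gamma> l where "multipliers M v \<gamma> l" "\<forall>i j. i \<noteq> j \<longrightarrow> m $ i $ j = \<gamma> $ i - l $ i $ j"
    "m \<in> off_diagonal"
    using assms(1) unfolding normal_cone_def by auto
  then show ?thesis
    using assms(2) unfolding normal_cone_def multipliers_def off_diagonal_def
    by (auto intro!: exI[of _ "t *\<^sub>R \<gamma>"] exI[of _ "t *\<^sub>R l"] simp: right_diff_distrib) blast
qed

lemma normal_cone_add:
  assumes "m \<in> normal_cone M v" "m' \<in> normal_cone M v"
  shows "m + m' \<in> normal_cone M v"
proof -
  obtain \<gamma> l \<gamma>' l' where "multipliers M v \<gamma> l" "\<forall>i j. i \<noteq> j \<longrightarrow> m $ i $ j = \<gamma> $ i - l $ i $ j"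
    "m \<in> off_diagonal" "multipliers M v \<gamma>' l'" "\<forall>i j. i \<noteq> j \<longrightarrow> m' $ i $ j = \<gamma>' $ i - l' $ i $ j"
    "m' \<in> off_diagonal"
    using assms unfolding normal_cone_def by auto
  then show ?thesis
    unfolding normal_cone_def multipliers_def off_diagonal_def
    by (auto intro!: exI[of _ "\<gamma> + \<gamma>'"] exI[of _ "l + l'"] simp: distrib_right) (metis add_0)+
qed

lemma convex_normal_cone: "convex (normal_cone M v)"
  by (intro convexI normal_cone_add normal_cone_scaleR)

text \<open>
  A zone \<open>i\<close> with saturated outflow bound has a destination \<open>s i\<close> with positive flow, where
  complementarity forces \<open>\<gamma> $ i = m $ i $ s i\<close>. This eliminates the multipliers and describes the cone by
  finitely many linear equations and inequalities.
\<close>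

lemma closed_normal_cone:
  fixes M :: "'n::finite market"
  assumes x0: "\<And>i. 0 < init_alloc M $ i" and v: "v \<in> flow_feasible M"
  shows "closed (normal_cone M v)"
proof -
  define sat where "sat i \<longleftrightarrow> (\<Sum>j | j \<noteq> i. v $ i $ j) = init_alloc M $ i" for i
  have "\<forall>i. \<exists>j. sat i \<longrightarrow> j \<noteq> i \<and> 0 < v $ i $ j"
    using saturated_zone_flow x0 unfolding sat_def by metis
  then obtain s where s: "\<And>i. sat i \<Longrightarrow> s i \<noteq> i" "\<And>i. sat i \<Longrightarrow> 0 < v $ i $ s i"
    by metis
  define g where "g m i = (if sat i then m $ i $ s i else 0)" for m :: "real^'n^'n" and i
  have "normal_cone M v = {m. (\<forall>i. m $ i $ i = 0) \<and> (\<forall>i. 0 \<le> g m i) \<and>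
     (\<forall>i j. i \<noteq> j \<longrightarrow> m $ i $ j \<le> g m i) \<and> (\<forall>i j. i \<noteq> j \<and> v $ i $ j \<noteq> 0 \<longrightarrow> m $ i $ j = g m i)}"
    (is "_ = ?R")
  proof (intro set_eqI iffI)
    fix m assume "m \<in> normal_cone M v"
    then obtain \<gamma> l where m: "m \<in> off_diagonal" "multipliers M v \<gamma> l"
      "\<forall>i j. i \<noteq> j \<longrightarrow> m $ i $ j = \<gamma> $ i - l $ i $ j"
      unfolding normal_cone_def by auto
    have "g m i = \<gamma> $ i" for i
    proof (cases "sat i")
      case True
      with m(2) s[OF True] have "l $ i $ s i = 0"
        unfolding multipliers_def by (metis mult_eq_0_iff less_irrefl)
      then show ?thesis using m(3) s(1)[OF True] True by (simp add: g_def)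
    next
      case False
      then show ?thesis using m(2) unfolding multipliers_def sat_def g_def by auto
    qed
    then show "m \<in> ?R"
      using m unfolding multipliers_def off_diagonal_def by auto
  next
    fix m assume m: "m \<in> ?R"
    have "multipliers M v (\<chi> i. g m i) (\<chi> i j. if i = j then 0 else g m i - m $ i $ j)"
      using m unfolding multipliers_def off_diagonal_def by (auto simp: g_def sat_def)
    then show "m \<in> normal_cone M v"
      using m unfolding normal_cone_def off_diagonal_def
      by (auto intro!: exI[of _ "\<chi> i. g m i"] exI[of _ "\<chi> i j. if i = j then 0 else g m i - m $ i $ j"])
  qed
  moreover have "continuous_on UNIV (\<lambda>m. g m i)" for i
    unfolding g_def by (cases "sat i") (auto intro!: continuous_intros)
  ultimately show ?thesis
    by (auto intro!: closed_Collect_conj closed_Collect_all closed_Collect_imp closed_Collect_eq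
        closed_Collect_le continuous_intros)
qed

text \<open>
  The admissible vectors \<open>\<beta>\<close> form a box, possibly with degenerate sides.
\<close>

lemma beta_box:
  fixes M :: "'n::finite market"
    and p v y d0
  assumes p: "\<And>i. 0 \<le> p $ i"
  defines "B \<equiv> {\<beta>. \<forall>i. \<beta> $ i \<in> beta_set M y d0 p v i}"
  shows "compact B" "convex B" "B \<noteq> {}"
proof -
  have "\<exists>lo hi. lo \<le> hi \<and> beta_set M y d0 p v i = {lo..hi}" for i
  proof (cases "demand M d0 p i - alloc M v i" "y $ i" rule: linorder_cases)
    case less
    then show ?thesis by (intro exI[of _ 0]) (simp add: beta_set_def)
  next
    case equal
    then show ?thesis using p[of i] by (intro exI[of _ 0] exI[of _ "p $ i"]) (simp add: beta_set_def)
  next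
    case greater
    then show ?thesis by (intro exI[of _ "p $ i"]) (simp add: beta_set_def)
  qed
  then obtain lo hi where lh: "\<And>i. lo i \<le> hi i" "\<And>i. beta_set M y d0 p v i = {lo i..hi i}"
    by metis
  have B: "B = cbox (\<chi> i. lo i) (\<chi> i. hi i)"
    unfolding B_def lh(2) by (auto simp: mem_box_cart)
  have "(\<chi> i. lo i) \<in> B" unfolding B using lh(1) by (simp add: mem_box_cart)
  then show "compact B" "convex B" "B \<noteq> {}" unfolding B by auto
qed

lemma reduced_cost_combination:
  assumes "s + t = 1"
  shows "reduced_cost M (s *\<^sub>R \<beta> + t *\<^sub>R \<beta>') = s *\<^sub>R reduced_cost M \<beta> + t *\<^sub>R reduced_cost M \<beta>'"
proof -
  have t: "t = 1 - s" using assms by simp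
  show ?thesis
    unfolding t by (simp add: vec_eq_iff reduced_cost_def algebra_simps)
qed

lemma continuous_on_reduced_cost: "continuous_on S (reduced_cost M)"
proof -
  have "continuous_on S (\<lambda>\<beta>. if i = j then 0 else
     commission M * (\<beta> $ i - \<beta> $ j) + realloc_cost M $ i $ j)" for i j
    by (cases "i = j") (auto intro!: continuous_intros)
  then show ?thesis
    unfolding reduced_cost_def by (intro continuous_on_vec_lambda)
qed

text \<open>
  The direction is the normal vector of a hyperplane that strictly separates the reduced costs
  from the opposite of the normal cone.
\<close>

lemma descent_direction:
  fixes M :: "'n::finite market"
  assumes x0: "\<And>i. 0 < init_alloc M $ i" and p: "\<And>i. 0 \<le> p $ i" and v: "v \<in> flow_feasible M"
    and none: "\<nexists>\<beta>. (\<forall>i. \<beta> $ i \<in> beta_set M y d0 p v i) \<and> - reduced_cost M \<beta> \<in> normal_cone M v"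
  obtains a where "a \<in> off_diagonal"
    and "\<And>i. (\<Sum>j | j \<noteq> i. v $ i $ j) = init_alloc M $ i \<Longrightarrow> (\<Sum>j | j \<noteq> i. a $ i $ j) \<le> 0"
    and "\<And>i j. i \<noteq> j \<Longrightarrow> v $ i $ j = 0 \<Longrightarrow> 0 \<le> a $ i $ j"
    and "\<And>\<beta>. \<forall>i. \<beta> $ i \<in> beta_set M y d0 p v i \<Longrightarrow> reduced_cost M \<beta> \<bullet> a < 0"
proof -
  define B where "B = {\<beta>. \<forall>i. \<beta> $ i \<in> beta_set M y d0 p v i}"
  note B = beta_box[where ?M = M and ?y = y and ?d0.0 = d0 and ?v = v, OF p, folded B_def]
  define C where "C = uminus ` normal_cone M v"
  define G where "G = reduced_cost M ` B"
  have "compact G" "G \<noteq> {}"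
    unfolding G_def using B by (auto intro!: compact_continuous_image continuous_on_reduced_cost)
  moreover have "convex G"
    unfolding G_def
  proof (rule convexI)
    fix g h and s t :: real
    assume st: "0 \<le> s" "0 \<le> t" "s + t = 1" and "g \<in> reduced_cost M ` B" "h \<in> reduced_cost M ` B"
    then obtain \<beta> \<beta>' where "\<beta> \<in> B" "\<beta>' \<in> B" "g = reduced_cost M \<beta>" "h = reduced_cost M \<beta>'"
      by auto
    then show "s *\<^sub>R g + t *\<^sub>R h \<in> reduced_cost M ` B"
      using convexD[OF B(2) _ _ st] reduced_cost_combination[OF st(3)] by (metis imageI)
  qed
  moreover have "convex C" "closed C"
    unfolding C_def using convex_normal_cone closed_normal_cone[OF x0 v]
    by (auto intro: convex_negations closed_negations)
  moreover have "G \<inter> C = {}"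
    using none unfolding G_def C_def B_def by auto
  ultimately obtain a b where ab: "\<And>x. x \<in> G \<Longrightarrow> a \<bullet> x < b" "\<And>x. x \<in> C \<Longrightarrow> b < a \<bullet> x"
    using separating_hyperplane_compact_closed[of G C] by metis
  have b: "b < 0"
    using ab(2)[of "- 0"] imageI[OF zero_in_normal_cone, of uminus M v, folded C_def] by simp
  have polar: "a \<bullet> m \<le> 0" if m: "m \<in> normal_cone M v" for m
  proof (rule ccontr)
    assume "\<not> a \<bullet> m \<le> 0"
    then have pos: "0 < a \<bullet> m" by simp
    then have "(- b / (a \<bullet> m)) *\<^sub>R m \<in> normal_cone M v"
      using b by (intro normal_cone_scaleR[OF m] divide_nonneg_pos) auto
    then have "- ((- b / (a \<bullet> m)) *\<^sub>R m) \<in> C"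
      unfolding C_def by (rule imageI)
    from ab(2)[OF this] pos show False by simp
  qed
  \<comment> \<open>the diagonal of \<open>a\<close> is irrelevant for both separated sets and is removed\<close>
  define a' where "a' = (\<chi> i j. if i = j then 0 else a $ i $ j)"
  have inner: "m \<bullet> a' = a \<bullet> m" if "m \<in> off_diagonal" for m
    unfolding inner_vec_def a'_def using that
    by (intro sum.cong refl) (auto simp: off_diagonal_def)
  show thesis
  proof (rule that)
    show "a' \<in> off_diagonal" by (simp add: a'_def off_diagonal_def)
    show "reduced_cost M \<beta> \<bullet> a' < 0" if "\<forall>i. \<beta> $ i \<in> beta_set M y d0 p v i" for \<beta>
    proof -
      have "reduced_cost M \<beta> \<in> off_diagonal" by (simp add: reduced_cost_def off_diagonal_def)
      then show ?thesis using inner ab(1)[of "reduced_cost M \<beta>"] b that by (auto simp: G_def B_def)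
    qed
    show "(\<Sum>j | j \<noteq> i. a' $ i $ j) \<le> 0" if sat: "(\<Sum>j | j \<noteq> i. v $ i $ j) = init_alloc M $ i" for i
    proof -
      \<comment> \<open>the gradient of the active outflow bound of zone \<open>i\<close>\<close>
      define m :: "real^'n^'n" where "m = (\<chi> k j. if k = i \<and> j \<noteq> i then 1 else 0)"
      have off: "m \<in> off_diagonal" by (simp add: m_def off_diagonal_def)
      have "m \<in> normal_cone M v"
      proof (rule normal_coneI[OF off])
        show "multipliers M v (axis i 1) 0"
          using sat by (auto simp: multipliers_def axis_def off_diagonal_def)
      qed (auto simp: m_def axis_def)
      then have "m \<bullet> a' \<le> 0" using polar inner[OF off] by simp
      moreover have "m \<bullet> a' = (\<Sum>k\<in>UNIV. if k = i then (\<Sum>j\<in>UNIV. if j \<noteq> i then a' $ i $ j else 0) else 0)"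
        unfolding inner_vec_def m_def by (intro sum.cong refl) (auto intro!: sum.cong)
      ultimately show ?thesis by (simp add: sum.If_cases Collect_neg_eq)
    qed
    show "0 \<le> a' $ i $ j" if "i \<noteq> j" "v $ i $ j = 0" for i j
    proof -
      \<comment> \<open>the gradient of the active constraint \<open>- v\<^sub>i\<^sub>j \<le> 0\<close>\<close>
      define m :: "real^'n^'n" where "m = - axis i (axis j 1)"
      have off: "m \<in> off_diagonal" using that by (auto simp: m_def off_diagonal_def axis_def)
      have "m \<in> normal_cone M v"
      proof (rule normal_coneI[OF off])
        show "multipliers M v 0 (- m)"
          using that off by (auto simp: multipliers_def m_def axis_def off_diagonal_def)
      qed simp
      then have "m \<bullet> a' \<le> 0" using polar inner[OF off] by simp
      then show ?thesis by (simp add: m_def inner_axis')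
    qed
  qed
qed

lemma feasible_direction:
  fixes M :: "'n::finite market"
  assumes v: "v \<in> flow_feasible M" and a: "a \<in> off_diagonal"
    and sat: "\<And>i. (\<Sum>j | j \<noteq> i. v $ i $ j) = init_alloc M $ i \<Longrightarrow> (\<Sum>j | j \<noteq> i. a $ i $ j) \<le> 0"
    and zero: "\<And>i j. i \<noteq> j \<Longrightarrow> v $ i $ j = 0 \<Longrightarrow> 0 \<le> a $ i $ j"
  shows "\<forall>\<^sub>F t in at_right 0. v + t *\<^sub>R a \<in> flow_feasible M"
proof -
  have sgn: "\<forall>\<^sub>F t in at_right 0. 0 \<le> r + t * s" if "0 \<le> r" "r = 0 \<Longrightarrow> 0 \<le> s" for r s :: real
  proof (cases "r = 0")
    case True
    then show ?thesis using that eventually_at_right_less[of "0::real"]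
      by (auto elim!: eventually_mono)
  next
    case False
    have "((\<lambda>t. r + t * s) \<longlongrightarrow> r) (at_right 0)" by (auto intro!: tendsto_eq_intros)
    then have "\<forall>\<^sub>F t in at_right 0. 0 < r + t * s"
      using False that(1) by (intro order_tendstoD(1)) auto
    then show ?thesis by (auto elim!: eventually_mono)
  qed
  have "\<forall>\<^sub>F t in at_right 0. i \<noteq> j \<longrightarrow> 0 \<le> v $ i $ j + t * a $ i $ j" for i j
    using sgn[of "v $ i $ j" "a $ i $ j"] v zero unfolding flow_feasible_def
    by (cases "i = j") auto
  then have 1: "\<forall>\<^sub>F t in at_right 0. \<forall>i j. i \<noteq> j \<longrightarrow> 0 \<le> v $ i $ j + t * a $ i $ j"
    by (intro eventually_all_finite)
  have "\<forall>\<^sub>F t in at_right 0. 0 \<le> (init_alloc M $ i - (\<Sum>j | j \<noteq> i. v $ i $ j)) + t * - (\<Sum>j | j \<noteq> i. a $ i $ j)" for i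
    using v sat[of i] unfolding flow_feasible_def by (intro sgn) auto
  then have 2: "\<forall>\<^sub>F t in at_right 0. \<forall>i. 0 \<le> (init_alloc M $ i - (\<Sum>j | j \<noteq> i. v $ i $ j)) + t * - (\<Sum>j | j \<noteq> i. a $ i $ j)"
    by (intro eventually_all_finite)
  show ?thesis
    using 1 2
  proof eventually_elim
    case (elim t)
    then show ?case using v a unfolding flow_feasible_def off_diagonal_def
      by (simp add: sum.distrib sum_distrib_left[symmetric] algebra_simps)
  qed
qed

text \<open>
  The Karush-Kuhn-Tucker conditions are necessary and sufficient for global minimizers of the
  follower's problem.
\<close>

lemma solves_follower_iff:
  fixes M :: "'n::finite market"
  assumes c: "0 < commission M" and x0: "\<And>i. 0 < init_alloc M $ i" and p: "\<And>i. 0 \<le> p $ i"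
  shows "solves_follower M y d0 p v \<longleftrightarrow> v \<in> flow_feasible M \<and>
    (\<exists>\<beta>. (\<forall>i. \<beta> $ i \<in> beta_set M y d0 p v i) \<and> - reduced_cost M \<beta> \<in> normal_cone M v)"
proof
  assume opt: "solves_follower M y d0 p v"
  then have v: "v \<in> flow_feasible M" by (simp add: solves_follower_def is_arg_min_def)
  moreover have "\<exists>\<beta>. (\<forall>i. \<beta> $ i \<in> beta_set M y d0 p v i) \<and> - reduced_cost M \<beta> \<in> normal_cone M v"
  proof (rule ccontr)
    assume "\<not> ?thesis"
    then obtain a where a: "a \<in> off_diagonal"
      "\<And>i. (\<Sum>j | j \<noteq> i. v $ i $ j) = init_alloc M $ i \<Longrightarrow> (\<Sum>j | j \<noteq> i. a $ i $ j) \<le> 0"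
      "\<And>i j. i \<noteq> j \<Longrightarrow> v $ i $ j = 0 \<Longrightarrow> 0 \<le> a $ i $ j"
      and desc: "\<And>\<beta>. \<forall>i. \<beta> $ i \<in> beta_set M y d0 p v i \<Longrightarrow> reduced_cost M \<beta> \<bullet> a < 0"
      using descent_direction[OF x0 p v] by blast
    obtain \<beta> where \<beta>: "\<forall>i. \<beta> $ i \<in> beta_set M y d0 p v i"
      and dir: "\<forall>\<^sub>F t in at_right 0. follower_cost M y d0 p (v + t *\<^sub>R a)
       = follower_cost M y d0 p v + t * (reduced_cost M \<beta> \<bullet> a)"
      using follower_cost_directional[OF p] by blast
    have feas: "\<forall>\<^sub>F t in at_right 0. v + t *\<^sub>R a \<in> flow_feasible M"
      by (rule feasible_direction) (use v a in auto)
    have "\<forall>\<^sub>F t in at_right (0::real). 0 < t \<and> v + t *\<^sub>R a \<in> flow_feasible M \<and>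
       follower_cost M y d0 p (v + t *\<^sub>R a) = follower_cost M y d0 p v + t * (reduced_cost M \<beta> \<bullet> a)"
      using feas dir eventually_at_right_less[of "0::real"]
      by eventually_elim simp
    then obtain t :: real where "0 < t" "v + t *\<^sub>R a \<in> flow_feasible M"
       "follower_cost M y d0 p (v + t *\<^sub>R a) = follower_cost M y d0 p v + t * (reduced_cost M \<beta> \<bullet> a)"
      using eventually_happens'[OF trivial_limit_at_right_real] by blast
    moreover from this have "t * (reduced_cost M \<beta> \<bullet> a) < 0"
      using desc[OF \<beta>] by (simp add: mult_pos_neg)
    ultimately show False
      using opt unfolding solves_follower_def is_arg_min_def by force
  qed
  ultimately show "v \<in> flow_feasible M \<and>
    (\<exists>\<beta>. (\<forall>i. \<beta> $ i \<in> beta_set M y d0 p v i) \<and> - reduced_cost M \<beta> \<in> normal_cone M v)" ..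
next
  assume "v \<in> flow_feasible M \<and>
    (\<exists>\<beta>. (\<forall>i. \<beta> $ i \<in> beta_set M y d0 p v i) \<and> - reduced_cost M \<beta> \<in> normal_cone M v)"
  then obtain \<beta> \<gamma> l where v: "v \<in> flow_feasible M"
    and \<beta>: "\<And>i. \<beta> $ i \<in> beta_set M y d0 p v i" and mult: "multipliers M v \<gamma> l"
    and "\<forall>i j. i \<noteq> j \<longrightarrow> (- reduced_cost M \<beta>) $ i $ j = \<gamma> $ i - l $ i $ j"
    unfolding normal_cone_def by auto
  then have stat: "\<And>i j. i \<noteq> j \<Longrightarrow> reduced_cost M \<beta> $ i $ j = l $ i $ j - \<gamma> $ i"
    by (metis minus_diff_eq minus_minus vector_uminus_component)
  have "follower_cost M y d0 p v \<le> follower_cost M y d0 p w" if w: "w \<in> flow_feasible M" for w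
  proof -
    have "0 \<le> (\<Sum>j | j \<noteq> i. reduced_cost M \<beta> $ i $ j * (w - v) $ i $ j)" for i
    proof -
      have "reduced_cost M \<beta> $ i $ j * (w - v) $ i $ j
        = l $ i $ j * w $ i $ j - \<gamma> $ i * w $ i $ j + \<gamma> $ i * v $ i $ j" if "j \<noteq> i" for j
      proof -
        have "l $ i $ j * v $ i $ j = 0" using mult that unfolding multipliers_def by metis
        then show ?thesis unfolding stat[OF that[symmetric]] by (simp add: algebra_simps)
      qed
      then have "(\<Sum>j | j \<noteq> i. reduced_cost M \<beta> $ i $ j * (w - v) $ i $ j) =
        (\<Sum>j | j \<noteq> i. l $ i $ j * w $ i $ j) - \<gamma> $ i * (\<Sum>j | j \<noteq> i. w $ i $ j) + \<gamma> $ i * (\<Sum>j | j \<noteq> i. v $ i $ j)"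
        by (simp add: sum.distrib sum_subtractf sum_distrib_left)
      moreover have "0 \<le> (\<Sum>j | j \<noteq> i. l $ i $ j * w $ i $ j)"
        using mult w unfolding multipliers_def flow_feasible_def by (intro sum_nonneg) force
      moreover have "\<gamma> $ i * (\<Sum>j | j \<noteq> i. w $ i $ j) \<le> \<gamma> $ i * init_alloc M $ i"
        using mult w unfolding multipliers_def flow_feasible_def by (simp add: mult_left_mono)
      moreover have "\<gamma> $ i * (\<Sum>j | j \<noteq> i. v $ i $ j) = \<gamma> $ i * init_alloc M $ i"
        using mult unfolding multipliers_def by auto
      ultimately show ?thesis by linarith
    qed
    then have "0 \<le> reduced_cost M \<beta> \<bullet> (w - v)"
      unfolding reduced_cost_inner by (rule sum_nonneg)
    then show ?thesis
      using follower_cost_subgradient[where w = w, OF _ p \<beta>] c by fastforce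
  qed
  then show "solves_follower M y d0 p v"
    using v unfolding solves_follower_def is_arg_min_def by (auto simp: not_less)
qed

section \<open>The set of stationary points\<close>

lemma price_box_nonneg:
  assumes "\<forall>i. 0 \<le> price_min M $ i" and "p \<in> price_box M"
  shows "0 \<le> p $ i"
  using assms unfolding price_box_def by (auto intro: order_trans)

lemma bilevel_feasible_projection:
  fixes M :: "'n::finite market"
  assumes "0 < commission M" and "\<And>i. 0 < init_alloc M $ i" and "\<forall>i. 0 \<le> price_min M $ i"
  shows "bilevel_feasible M y d0 = (\<lambda>(p, v, l, \<gamma>, \<beta>). (p, v)) ` mpcc_feasible M y d0"
proof -
  have "(p, v) \<in> bilevel_feasible M y d0 \<longleftrightarrow> (\<exists>l \<gamma> \<beta>. (p, v, l, \<gamma>, \<beta>) \<in> mpcc_feasible M y d0)" for p v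
  proof (cases "p \<in> price_box M")
    case True
    have "- reduced_cost M \<beta> \<in> normal_cone M v \<longleftrightarrow> (\<exists>\<gamma> l. multipliers M v \<gamma> l \<and>
       (\<forall>i j. i \<noteq> j \<longrightarrow> reduced_cost M \<beta> $ i $ j = l $ i $ j - \<gamma> $ i))" for \<beta>
    proof -
      have "- reduced_cost M \<beta> \<in> off_diagonal" by (simp add: off_diagonal_def reduced_cost_def)
      moreover have "(- reduced_cost M \<beta>) $ i $ j = \<gamma> $ i - l $ i $ j \<longleftrightarrow> reduced_cost M \<beta> $ i $ j = l $ i $ j - \<gamma> $ i"
        for i j l \<gamma> by auto
      ultimately show ?thesis unfolding normal_cone_def by simp
    qed
    moreover have "0 \<le> p $ i" for i using price_box_nonneg[OF assms(3) True] .
    ultimately show ?thesis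
      using True unfolding bilevel_feasible_def mpcc_feasible_iff
      by (auto simp: solves_follower_iff[OF assms(1,2)])
  next
    case False
    then show ?thesis by (simp add: bilevel_feasible_def mpcc_feasible_iff)
  qed
  then show ?thesis by (force simp: image_iff)
qed

lemma beta_bounds:
  assumes "\<forall>i. 0 \<le> price_min M $ i" "p \<in> price_box M" "\<beta> $ i \<in> beta_set M y d0 p v i"
  shows "0 \<le> \<beta> $ i" "\<beta> $ i \<le> p $ i"
  using assms(3) price_box_nonneg[OF assms(1,2), of i] unfolding beta_set_def
  by (auto split: if_splits)

lemma price_le_Max:
  assumes "p \<in> price_box M"
  shows "p $ i \<le> Max (range (\<lambda>k. price_max M $ k))"
proof -
  have "p $ i \<le> price_max M $ i" using assms by (auto simp: price_box_def)
  also have "\<dots> \<le> Max (range (\<lambda>k. price_max M $ k))" by (intro Max_ge) auto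
  finally show ?thesis .
qed

text \<open>
  The bounds are half the price terms of those in the theorem.
\<close>

lemma multiplier_bounds:
  fixes M :: "'n::finite market"
  assumes c: "0 < commission M" "commission M < 1" and pm: "\<forall>i. 0 \<le> price_min M $ i"
    and \<alpha>: "\<forall>i j. i \<noteq> j \<longrightarrow> 0 \<le> realloc_cost M $ i $ j" and x0: "\<And>i. 0 < init_alloc M $ i"
    and feas: "(p, v, l, \<gamma>, \<beta>) \<in> mpcc_feasible M y d0"
  defines "P \<equiv> Max (range (\<lambda>k. price_max M $ k))"
  shows "\<gamma> $ i \<le> P" and "i \<noteq> j \<Longrightarrow> l $ i $ j \<le> 2 * P + realloc_cost M $ i $ j"
proof -
  have p: "p \<in> price_box M" and v: "v \<in> flow_feasible M" and mult: "multipliers M v \<gamma> l"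
    and stat: "\<And>i j. i \<noteq> j \<Longrightarrow> reduced_cost M \<beta> $ i $ j = l $ i $ j - \<gamma> $ i"
    and \<beta>: "\<And>i. \<beta> $ i \<in> beta_set M y d0 p v i"
    using feas unfolding mpcc_feasible_iff by auto
  have \<beta>': "0 \<le> \<beta> $ i" "\<beta> $ i \<le> P" for i
    using beta_bounds[OF pm p \<beta>, of i] price_le_Max[OF p, of i] unfolding P_def by auto
  then have P: "0 \<le> P" by (meson order_trans)
  have diff: "commission M * (\<beta> $ i - \<beta> $ j) \<le> P" for i j
  proof -
    have "commission M * (\<beta> $ i - \<beta> $ j) \<le> commission M * P"
      using \<beta>'[of i] \<beta>'[of j] c by (intro mult_left_mono) auto
    also have "\<dots> \<le> P" using c P by (simp add: mult_left_le_one_le)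
    finally show ?thesis .
  qed
  have \<gamma>: "\<gamma> $ i \<le> P" for i
  proof (cases "\<gamma> $ i = 0")
    case True
    then show ?thesis using P by simp
  next
    case False
    then have "(\<Sum>j | j \<noteq> i. v $ i $ j) = init_alloc M $ i"
      using mult unfolding multipliers_def by (metis mult_eq_0_iff eq_iff_diff_eq_0)
    then obtain j where j: "j \<noteq> i" "0 < v $ i $ j" using saturated_zone_flow[OF x0] by blast
    then have "l $ i $ j = 0" using mult unfolding multipliers_def by (metis mult_eq_0_iff less_irrefl)
    then have "\<gamma> $ i = commission M * (\<beta> $ j - \<beta> $ i) - realloc_cost M $ i $ j"
      using stat[of i j] j(1) by (simp add: reduced_cost_def algebra_simps)
    then show ?thesis using diff[of j i] \<alpha> j(1) by (metis diff_le_eq le_add_same_cancel1 order_trans)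
  qed
  then show "\<gamma> $ i \<le> P" .
  show "l $ i $ j \<le> 2 * P + realloc_cost M $ i $ j" if "i \<noteq> j"
    using stat[OF that] that diff[of i j] \<gamma>[of i] by (simp add: reduced_cost_def)
qed

lemma bounded_vec_matrix:
  fixes S :: "(real^'n::finite) set" and T :: "(real^'n^'n) set"
  shows "(\<And>x i. x \<in> S \<Longrightarrow> \<bar>x $ i\<bar> \<le> b) \<Longrightarrow> bounded S"
    and "(\<And>x i j. x \<in> T \<Longrightarrow> \<bar>x $ i $ j\<bar> \<le> b) \<Longrightarrow> bounded T"
proof -
  show "bounded S" if "\<And>x i. x \<in> S \<Longrightarrow> \<bar>x $ i\<bar> \<le> b"
    unfolding bounded_iff
    by (intro exI[of _ "norm (\<chi> i::'n. b)"] ballI norm_le_componentwise_cart)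
      (use that in \<open>auto intro: order_trans[OF _ abs_ge_self]\<close>)
  show "bounded T" if "\<And>x i j. x \<in> T \<Longrightarrow> \<bar>x $ i $ j\<bar> \<le> b"
    unfolding bounded_iff
    by (intro exI[of _ "norm (\<chi> (i::'n) (j::'n). b)"] ballI norm_le_componentwise_cart)
      (use that in \<open>auto intro: order_trans[OF _ abs_ge_self]\<close>)
qed

lemma flow_le_init_alloc:
  assumes "v \<in> flow_feasible M" "i \<noteq> j"
  shows "v $ i $ j \<le> init_alloc M $ i"
proof -
  have "v $ i $ j \<le> (\<Sum>j | j \<noteq> i. v $ i $ j)"
    using assms unfolding flow_feasible_def by (intro member_le_sum) auto
  also have "\<dots> \<le> init_alloc M $ i" using assms unfolding flow_feasible_def by auto
  finally show ?thesis .
qed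

lemma bounded_mpcc_feasible:
  fixes M :: "'n::finite market"
  assumes c: "0 < commission M" "commission M < 1" and pm: "\<forall>i. 0 \<le> price_min M $ i"
    and \<alpha>: "\<forall>i j. i \<noteq> j \<longrightarrow> 0 \<le> realloc_cost M $ i $ j" and x0: "\<And>i. 0 < init_alloc M $ i"
  shows "bounded (mpcc_feasible M y d0)"
proof -
  define P where "P = Max (range (\<lambda>k. price_max M $ k))"
  define A where "A = Max (range (\<lambda>(i, j). \<bar>realloc_cost M $ i $ j\<bar>))"
  define X where "X = Max (range (\<lambda>i. init_alloc M $ i))"
  have A: "realloc_cost M $ i $ j \<le> A" for i j
  proof -
    have "\<bar>realloc_cost M $ i $ j\<bar> \<le> A"
      unfolding A_def by (intro Max_ge) (auto intro!: image_eqI[of _ _ "(i, j)"])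
    then show ?thesis by simp
  qed
  have X: "init_alloc M $ i \<le> X" for i unfolding X_def by (intro Max_ge) auto
  have X0: "0 \<le> X" using X x0 by (meson less_imp_le order_trans)
  have A0: "0 \<le> A" unfolding A_def by (intro Max_ge_iff[THEN iffD2]) auto
  have *: "\<bar>p $ i\<bar> \<le> P" "\<bar>v $ i $ j\<bar> \<le> X" "\<bar>l $ i $ j\<bar> \<le> 2 * P + A" "\<bar>\<gamma> $ i\<bar> \<le> P" "\<bar>\<beta> $ i\<bar> \<le> P"
    if f: "(p, v, l, \<gamma>, \<beta>) \<in> mpcc_feasible M y d0" for p v l \<gamma> \<beta> i j
  proof -
    have p: "p \<in> price_box M" and v: "v \<in> flow_feasible M" and mult: "multipliers M v \<gamma> l"
      and \<beta>: "\<beta> $ i \<in> beta_set M y d0 p v i"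
      using f unfolding mpcc_feasible_iff by auto
    note b = multiplier_bounds[OF c pm \<alpha> x0 f, folded P_def]
    have p0: "0 \<le> p $ i" "p $ i \<le> P"
      using price_box_nonneg[OF pm p] price_le_Max[OF p] unfolding P_def by auto
    then show "\<bar>p $ i\<bar> \<le> P" by simp
    show "\<bar>v $ i $ j\<bar> \<le> X"
      using flow_le_init_alloc[OF v, of i j] X[of i] X0 v
      unfolding flow_feasible_def off_diagonal_def by (cases "i = j") force+
    show "\<bar>l $ i $ j\<bar> \<le> 2 * P + A"
      using b(2)[of i j] A[of i j] p0 A0 mult
      unfolding multipliers_def off_diagonal_def by (cases "i = j") force+
    show "\<bar>\<gamma> $ i\<bar> \<le> P" using b(1)[of i] mult unfolding multipliers_def by auto
    show "\<bar>\<beta> $ i\<bar> \<le> P" using beta_bounds[OF pm p \<beta>] p0 by auto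
  qed
  have "bounded ({p::real^'n. \<forall>i. \<bar>p $ i\<bar> \<le> P} \<times> {v::real^'n^'n. \<forall>i j. \<bar>v $ i $ j\<bar> \<le> X} \<times>
    {l::real^'n^'n. \<forall>i j. \<bar>l $ i $ j\<bar> \<le> 2 * P + A} \<times> {\<gamma>::real^'n. \<forall>i. \<bar>\<gamma> $ i\<bar> \<le> P} \<times> {\<beta>::real^'n. \<forall>i. \<bar>\<beta> $ i\<bar> \<le> P})"
    by (intro bounded_Times; rule bounded_vec_matrix; blast)
  then show ?thesis
    by (rule bounded_subset) (use * in auto)
qed

text \<open>
  The condition on \<open>\<beta>\<^sub>i\<close> as a conjunction of closed conditions: the premises of both implications
  are strict inequalities.
\<close>

lemma beta_set_iff:
  assumes "0 \<le> p $ i"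
  shows "b \<in> beta_set M y d0 p v i \<longleftrightarrow> 0 \<le> b \<and> b \<le> p $ i \<and>
    (demand M d0 p i - alloc M v i < y $ i \<longrightarrow> b = 0) \<and>
    (y $ i < demand M d0 p i - alloc M v i \<longrightarrow> b = p $ i)"
  using assms unfolding beta_set_def by auto

lemma closed_mpcc_feasible:
  fixes M :: "'n::finite market"
  assumes pm: "\<forall>i. 0 \<le> price_min M $ i"
  shows "closed (mpcc_feasible M y d0)"
proof -
  \<comment> \<open>a zero denominator in the demand makes it constant, since division by zero yields zero\<close>
  have demand: "continuous_on UNIV (\<lambda>z::'n mpcc_point. demand M d0 (fst z) i)" for i
    unfolding demand_def by (cases "price_max M $ i - price_min M $ i = 0") (auto intro!: continuous_intros)
  have alloc: "continuous_on UNIV (\<lambda>z::'n mpcc_point. alloc M (fst (snd z)) i)" for i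
    unfolding alloc_def by (intro continuous_intros)
  have "mpcc_feasible M y d0 = {z. case z of (p, v, l, \<gamma>, \<beta>) \<Rightarrow>
     v \<in> off_diagonal \<and> l \<in> off_diagonal \<and> p \<in> price_box M \<and>
     (\<forall>i. (\<Sum>j | j \<noteq> i. v $ i $ j) - init_alloc M $ i \<le> 0) \<and>
     (\<forall>i j. i \<noteq> j \<longrightarrow>
        commission M * (\<beta> $ i - \<beta> $ j) + realloc_cost M $ i $ j - l $ i $ j + \<gamma> $ i = 0) \<and>
     (\<forall>i. \<gamma> $ i * ((\<Sum>j | j \<noteq> i. v $ i $ j) - init_alloc M $ i) = 0) \<and>
     (\<forall>i j. i \<noteq> j \<longrightarrow> l $ i $ j * v $ i $ j = 0) \<and>
     (\<forall>i j. i \<noteq> j \<longrightarrow> 0 \<le> v $ i $ j) \<and>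
     (\<forall>i. 0 \<le> \<gamma> $ i) \<and>
     (\<forall>i j. i \<noteq> j \<longrightarrow> 0 \<le> l $ i $ j) \<and>
     (\<forall>i. 0 \<le> \<beta> $ i \<and> \<beta> $ i \<le> p $ i \<and>
        (demand M d0 p i - alloc M v i < y $ i \<longrightarrow> \<beta> $ i = 0) \<and>
        (y $ i < demand M d0 p i - alloc M v i \<longrightarrow> \<beta> $ i = p $ i))}"
    unfolding mpcc_feasible_def
    by (auto simp: beta_set_iff price_box_nonneg[OF pm])
  then show ?thesis
    unfolding off_diagonal_def price_box_def case_prod_beta mem_Collect_eq atLeastAtMost_iff
    by (auto intro!: closed_Collect_conj closed_Collect_disj closed_Collect_all closed_Collect_imp open_Collect_less
        closed_Collect_le closed_Collect_eq continuous_intros demand alloc)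
qed

theorem proposition4p3:
  fixes M :: "'n::finite market"
    and y d0 :: "real^'n"
  assumes "0 < commission M" and "commission M < 1"
    and "\<forall>i. 0 \<le> price_min M $ i \<and> price_min M $ i < price_max M $ i"
    and "\<forall>i j. i \<noteq> j \<longrightarrow> 0 \<le> realloc_cost M $ i $ j"
    and "\<forall>i. 0 < init_alloc M $ i"
    and "\<forall>i. 0 \<le> y $ i" and "\<forall>i. 0 \<le> d0 $ i"
  shows
    "(\<forall>p v.
        global_solution (bilevel_objective M y d0) (bilevel_feasible M y d0) (p, v) \<longleftrightarrow>
        (\<exists>l \<gamma> \<beta>. global_solution (mpcc_objective M y d0) (mpcc_feasible M y d0) (p, v, l, \<gamma>, \<beta>)))
     \<and> (\<forall>p v. (p, v) \<in> bilevel_feasible M y d0 \<longrightarrow>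
        (local_solution (bilevel_objective M y d0) (bilevel_feasible M y d0) (p, v) \<longleftrightarrow>
         (\<forall>l \<gamma> \<beta>. (p, v, l, \<gamma>, \<beta>) \<in> mpcc_feasible M y d0 \<longrightarrow>
            local_solution (mpcc_objective M y d0) (mpcc_feasible M y d0) (p, v, l, \<gamma>, \<beta>))))
     \<and> (\<forall>p v l \<gamma> \<beta>. (p, v, l, \<gamma>, \<beta>) \<in> mpcc_feasible M y d0 \<longrightarrow>
        (\<forall>i. 0 \<le> \<gamma> $ i \<and> \<gamma> $ i \<le> 2 * Max (range (\<lambda>k. price_max M $ k))) \<and>
        (\<forall>i j. i \<noteq> j \<longrightarrow>
           0 \<le> l $ i $ j \<and>
           l $ i $ j \<le> 4 * Max (range (\<lambda>k. price_max M $ k)) + realloc_cost M $ i $ j))"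
proof -
  let ?\<pi> = "\<lambda>(p, v, l, \<gamma>, \<beta>). (p, v) :: (real^'n) \<times> (real^'n^'n)"
  let ?S = "mpcc_feasible M y d0"
  have x0: "\<And>i. 0 < init_alloc M $ i" and pm: "\<forall>i. 0 \<le> price_min M $ i"
    using assms(3,5) by auto
  have proj: "bilevel_feasible M y d0 = ?\<pi> ` ?S"
    by (rule bilevel_feasible_projection[OF assms(1) x0 pm])
  have obj: "mpcc_objective M y d0 = bilevel_objective M y d0 \<circ> ?\<pi>"
    by (auto simp: mpcc_objective_def bilevel_objective_def)
  have comp: "compact ?S"
    using bounded_mpcc_feasible[OF assms(1,2) pm assms(4) x0] closed_mpcc_feasible[OF pm]
    by (simp add: compact_eq_bounded_closed)
  have cont: "continuous_on UNIV ?\<pi>"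
    unfolding case_prod_beta by (intro continuous_intros)
  have "global_solution (bilevel_objective M y d0) (bilevel_feasible M y d0) (p, v) \<longleftrightarrow>
        (\<exists>l \<gamma> \<beta>. global_solution (mpcc_objective M y d0) ?S (p, v, l, \<gamma>, \<beta>))" for p v
    unfolding proj obj global_solution_project
    by (auto simp: Bex_def dest: global_solution_mem)
  moreover have "local_solution (bilevel_objective M y d0) (bilevel_feasible M y d0) (p, v) \<longleftrightarrow>
         (\<forall>l \<gamma> \<beta>. (p, v, l, \<gamma>, \<beta>) \<in> ?S \<longrightarrow>
            local_solution (mpcc_objective M y d0) ?S (p, v, l, \<gamma>, \<beta>))"
    if "(p, v) \<in> bilevel_feasible M y d0" for p v
    using local_solution_project[OF comp cont that[unfolded proj], of "bilevel_objective M y d0"]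
    unfolding proj obj by auto
  moreover have "(0 \<le> \<gamma> $ i \<and> \<gamma> $ i \<le> 2 * Max (range (\<lambda>k. price_max M $ k))) \<and>
     (i \<noteq> j \<longrightarrow> 0 \<le> l $ i $ j \<and>
        l $ i $ j \<le> 4 * Max (range (\<lambda>k. price_max M $ k)) + realloc_cost M $ i $ j)"
    if f: "(p, v, l, \<gamma>, \<beta>) \<in> ?S" for p v l \<gamma> \<beta> i j
  proof -
    have "0 \<le> \<gamma> $ i" "i \<noteq> j \<longrightarrow> 0 \<le> l $ i $ j"
      using f unfolding mpcc_feasible_iff multipliers_def by auto
    then show ?thesis
      using multiplier_bounds[OF assms(1,2) pm assms(4) x0 f, of i]
        multiplier_bounds(2)[OF assms(1,2) pm assms(4) x0 f, of i j] by linarith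
  qed
  ultimately show ?thesis by blast
qed

end
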